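(* Let $a,b:\mathbb{N}\to\mathbb{R}$ be sequences with $\sum_{n=0}^\infty(|a_n|+|b_n|)<\infty$. Then, as $N\to\infty$, the partial sums $$S_N(x)=\tfrac12a_0+\sum_{n=1}^N\bigl(a_n\cos(nx)+b_n\sin(nx)\bigr)$$ converge uniformly on $\mathbb{R}$ to $$F(x)=\tfrac12a_0+\sum_{n=1}^\infty\bigl(a_n\cos(nx)+b_n\sin(nx)\bigr).$$
   Context: The sequences $a,b$ are arbitrary real sequences indexed by $\mathbb{N}=\{0,1,2,\dots\}$; they are not assumed to be the Fourier coefficients of a given function. *)

theory Defs
  imports "HOL-Analysis.Analysis"
begin

definition trig_partial_sum :: "(nat \<Rightarrow> real) \<Rightarrow> (nat \<Rightarrow> real) \<Rightarrow> nat \<Rightarrow> real \<Rightarrow> real" where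
  "trig_partial_sum a b N x =
     a 0 / 2 + (\<Sum>n = 1..N. a n * cos (real n * x) + b n * sin (real n * x))"

(* The series starts at index 1, hence the shift by Suc. *)
definition trig_series :: "(nat \<Rightarrow> real) \<Rightarrow> (nat \<Rightarrow> real) \<Rightarrow> real \<Rightarrow> real" where
  "trig_series a b x =
     a 0 / 2 + (\<Sum>n. a (Suc n) * cos (real (Suc n) * x) + b (Suc n) * sin (real (Suc n) * x))"

end

theory Submission
  imports Defs
begin

text \<open>
  Since sine and cosine are bounded by 1, the \<open>n\<close>-th term of the series is dominated, uniformly
  in \<open>x\<close>, by \<open>\<bar>a n\<bar> + \<bar>b n\<bar>\<close>, so the Weierstrass M-test applies.
\<close>

lemma abs_trig_term_le:
  fixes p q s t :: real
  shows "\<bar>p * cos s + q * sin t\<bar> \<le> \<bar>p\<bar> + \<bar>q\<bar>"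
proof -
  have "\<bar>p * cos s\<bar> \<le> \<bar>p\<bar>" and "\<bar>q * sin t\<bar> \<le> \<bar>q\<bar>"
    by (simp_all add: abs_mult mult_left_le)
  then show ?thesis
    by linarith
qed

theorem lemma3p4:
  fixes a b :: "nat \<Rightarrow> real"
  assumes "summable (\<lambda>n. \<bar>a n\<bar> + \<bar>b n\<bar>)"
  shows "uniform_limit UNIV (trig_partial_sum a b) (trig_series a b) sequentially"
proof -
  define f where
    "f n x = a (Suc n) * cos (real (Suc n) * x) + b (Suc n) * sin (real (Suc n) * x)" for n x
  have "summable (\<lambda>n. \<bar>a (Suc n)\<bar> + \<bar>b (Suc n)\<bar>)"
    using assms by (subst summable_Suc_iff)
  moreover have "norm (f n x) \<le> \<bar>a (Suc n)\<bar> + \<bar>b (Suc n)\<bar>" for n x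
    unfolding f_def real_norm_def by (rule abs_trig_term_le)
  ultimately have "uniform_limit UNIV (\<lambda>N x. \<Sum>n<N. f n x) (\<lambda>x. \<Sum>n. f n x) sequentially"
    by (intro Weierstrass_m_test)
  then have "uniform_limit UNIV (\<lambda>N x. a 0 / 2 + (\<Sum>n<N. f n x))
               (\<lambda>x. a 0 / 2 + (\<Sum>n. f n x)) sequentially"
    by (intro uniform_limit_intros)
  moreover have "trig_partial_sum a b = (\<lambda>N x. a 0 / 2 + (\<Sum>n<N. f n x))"
    by (simp add: fun_eq_iff trig_partial_sum_def f_def sum.atLeast1_atMost_eq)
  moreover have "trig_series a b = (\<lambda>x. a 0 / 2 + (\<Sum>n. f n x))"
    by (simp add: fun_eq_iff trig_series_def f_def)
  ultimately show ?thesis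
    by simp
qed

end
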